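(* Let $a,b,c,d:[t_0,+\infty)\to\mathbb{H}$ be continuous, and let $\mathcal{L}_n(t)$, $n=0,1,2,3$, be the ordered quintuples defined in the context. Suppose that for some $\varepsilon>0$ and for every $t\ge t_0$ the quintuples $\mathcal{L}_0(t),\mathcal{L}_1(t),\mathcal{L}_2(t),\mathcal{L}_3(t)$ are $\varepsilon$-semi definite positive. Then for all real $\gamma_n>0$, $n=0,1,2,3$, the quaternionic Riccati equation $$q'+q\,a(t)\,q+b(t)\,q+q\,c(t)+d(t)=0,\qquad t\ge t_0,$$ has a solution $q(t)=q_0(t)-i\,q_1(t)-j\,q_2(t)-k\,q_3(t)$ ($q_0,\dots,q_3$ real valued) on $[t_0,+\infty)$ with $q_n(t_0)=\gamma_n$, $n=0,1,2,3$, and $$q_n(t)>0,\qquad t\ge t_0,\ n=0,1,2,3.$$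
   Context: $\mathbb{H}$ denotes the real quaternions with imaginary units $i,j,k$ satisfying $i^2=j^2=k^2=ijk=-1$, $ij=-ji=k$. Write $a(t)=a_0(t)+i\,a_1(t)+j\,a_2(t)+k\,a_3(t)$ with $a_n$ real valued, and similarly $b(t)=b_0+ib_1+jb_2+kb_3$, $c(t)=c_0+ic_1+jc_2+kc_3$, $d(t)=d_0+id_1+jd_2+kd_3$; all component functions are continuous real valued functions on $[t_0,+\infty)$. A solution of the Riccati equation is a continuously differentiable quaternion-valued function satisfying it. Definition. For $\varepsilon>0$, an ordered quintuple $(p,q,r,s,l)$ of real numbers is called $\varepsilon$-semi definite positive if: 1) $p>0$ and $l>0$; and 2) either $\max\{q,r,s\}\ge\sqrt{l+\varepsilon}$, or else $0\le\min\{q,r,s\}\le\max\{q,r,s\}\le\sqrt{l+\varepsilon}$ and $q^2+r^2+s^2\ge l+\varepsilon$. For $t\ge t_0$ put - $p_{0,m}=b_m+c_m$, $m=1,2,3$; - $p_{1,1}=b_1+c_1$, $p_{1,2}=b_2-c_2$, $p_{1,3}=b_3-c_3$; - $p_{2,1}=b_1-c_1$, $p_{2,2}=b_2+c_2$, $p_{2,3}=b_3-c_3$; - $p_{3,1}=b_1-c_1$, $p_{3,2}=b_2-c_2$, $p_{3,3}=b_3+c_3$. Define $D_0(t)=\sum_{m=1}^3 p_{0,m}^2(t)+4a_0(t)d_0(t)$ if $a_0(t)\ne0$ and $D_0(t)=4d_0(t)$ if $a_0(t)=0$; for $n=1,2,3$, $D_n(t)=\sum_{m=1}^3 p_{n,m}^2(t)-4a_n(t)d_n(t)$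 if $a_n(t)\ne 0$ and $D_n(t)=-4d_n(t)$ if $a_n(t)=0$. The quintuples are $$\mathcal{L}_0(t)=(a_0(t),\,-b_1(t)-c_1(t),\,-b_2(t)-c_2(t),\,-b_3(t)-c_3(t),\,D_0(t)),$$ $$\mathcal{L}_1(t)=(a_1(t),\,b_1(t)+c_1(t),\,-b_2(t)+c_2(t),\,b_3(t)-c_3(t),\,D_1(t)),$$ $$\mathcal{L}_2(t)=(a_2(t),\,b_1(t)-c_1(t),\,b_2(t)+c_2(t),\,-b_3(t)+c_3(t),\,D_2(t)),$$ $$\mathcal{L}_3(t)=(a_3(t),\,-b_1(t)+c_1(t),\,b_2(t)-c_2(t),\,b_3(t)+c_3(t),\,D_3(t)).$$ *)

theory Defs
  imports "HOL-Analysis.Analysis"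
begin

section \<open>The real quaternions\<close>

datatype quat = Quat (quat_re: real) (quat_im1: real) (quat_im2: real) (quat_im3: real)

instantiation quat :: ring_1
begin

definition zero_quat :: quat where "0 = Quat 0 0 0 0"

definition one_quat :: quat where "1 = Quat 1 0 0 0"

definition plus_quat :: "quat \<Rightarrow> quat \<Rightarrow> quat" where
  "x + y = Quat (quat_re x + quat_re y) (quat_im1 x + quat_im1 y)
                (quat_im2 x + quat_im2 y) (quat_im3 x + quat_im3 y)"

definition uminus_quat :: "quat \<Rightarrow> quat" where
  "- x = Quat (- quat_re x) (- quat_im1 x) (- quat_im2 x) (- quat_im3 x)"

definition minus_quat :: "quat \<Rightarrow> quat \<Rightarrow> quat" where
  "x - y = Quat (quat_re x - quat_re y) (quat_im1 x - quat_im1 y)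
                (quat_im2 x - quat_im2 y) (quat_im3 x - quat_im3 y)"

definition times_quat :: "quat \<Rightarrow> quat \<Rightarrow> quat" where
  "x * y = Quat
     (quat_re x * quat_re y - quat_im1 x * quat_im1 y
        - quat_im2 x * quat_im2 y - quat_im3 x * quat_im3 y)
     (quat_re x * quat_im1 y + quat_im1 x * quat_re y
        + quat_im2 x * quat_im3 y - quat_im3 x * quat_im2 y)
     (quat_re x * quat_im2 y - quat_im1 x * quat_im3 y
        + quat_im2 x * quat_re y + quat_im3 x * quat_im1 y)
     (quat_re x * quat_im3 y + quat_im1 x * quat_im2 y
        - quat_im2 x * quat_im1 y + quat_im3 x * quat_re y)"

instance
  by standard
    (auto simp: zero_quat_def one_quat_def plus_quat_def uminus_quat_def minus_quat_def
        times_quat_def algebra_simps)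

end

instantiation quat :: real_algebra_1
begin

definition scaleR_quat :: "real \<Rightarrow> quat \<Rightarrow> quat" where
  "r *\<^sub>R x = Quat (r * quat_re x) (r * quat_im1 x) (r * quat_im2 x) (r * quat_im3 x)"

instance
  by standard (auto simp: scaleR_quat_def plus_quat_def times_quat_def algebra_simps)

end

instantiation quat :: real_inner
begin

definition inner_quat :: "quat \<Rightarrow> quat \<Rightarrow> real" where
  "x \<bullet> y = quat_re x * quat_re y + quat_im1 x * quat_im1 y
           + quat_im2 x * quat_im2 y + quat_im3 x * quat_im3 y"

definition norm_quat :: "quat \<Rightarrow> real" where "norm (x::quat) = sqrt (x \<bullet> x)"

definition sgn_quat :: "quat \<Rightarrow> quat" where "sgn (x::quat) = x /\<^sub>R norm x"

definition dist_quat :: "quat \<Rightarrow> quat \<Rightarrow> real" where "dist (x::quat) y = norm (x - y)"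

definition uniformity_quat :: "(quat \<times> quat) filter" where
  "uniformity = (INF e\<in>{0<..}. principal {(x::quat, y). dist x y < e})"

definition open_quat :: "quat set \<Rightarrow> bool" where
  "open (U :: quat set) \<longleftrightarrow> (\<forall>x\<in>U. eventually (\<lambda>(x', y). x' = x \<longrightarrow> y \<in> U) uniformity)"

instance
proof
  fix x y z :: quat and r :: real and U :: "quat set"
  show "dist x y = norm (x - y)" by (rule dist_quat_def)
  show "sgn x = x /\<^sub>R norm x" by (rule sgn_quat_def)
  show "uniformity = (INF e\<in>{0<..}. principal {(x::quat, y). dist x y < e})"
    by (rule uniformity_quat_def)
  show "open U \<longleftrightarrow> (\<forall>x\<in>U. eventually (\<lambda>(x', y). x' = x \<longrightarrow> y \<in> U) uniformity)"
    by (rule open_quat_def)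
  show "x \<bullet> y = y \<bullet> x" by (simp add: inner_quat_def mult.commute)
  show "(x + y) \<bullet> z = x \<bullet> z + y \<bullet> z"
    by (simp add: inner_quat_def plus_quat_def algebra_simps)
  show "r *\<^sub>R x \<bullet> y = r * (x \<bullet> y)"
    by (simp add: inner_quat_def scaleR_quat_def algebra_simps)
  show "0 \<le> x \<bullet> x" by (simp add: inner_quat_def)
  have "x \<bullet> x = (quat_re x)\<^sup>2 + (quat_im1 x)\<^sup>2 + ((quat_im2 x)\<^sup>2 + (quat_im3 x)\<^sup>2)"
    by (simp add: inner_quat_def power2_eq_square)
  then show "x \<bullet> x = 0 \<longleftrightarrow> x = 0"
    by (cases x) (auto simp: zero_quat_def add_nonneg_eq_0_iff sum_power2_eq_zero_iff)
  show "norm x = sqrt (x \<bullet> x)" by (rule norm_quat_def)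
qed

end

lemma norm_mult_quat: "norm (x * y) = norm x * norm (y::quat)"
proof -
  have "(x * y) \<bullet> (x * y) = (x \<bullet> x) * (y \<bullet> y)"
    by (simp add: inner_quat_def times_quat_def algebra_simps)
  then show ?thesis by (simp add: norm_quat_def real_sqrt_mult)
qed

instance quat :: real_normed_algebra_1
proof
  fix x y :: quat
  show "norm (x * y) \<le> norm x * norm y" by (simp add: norm_mult_quat)
  show "norm (1::quat) = 1" by (simp add: norm_quat_def inner_quat_def one_quat_def)
qed

definition quat_i :: quat where "quat_i = Quat 0 1 0 0"
definition quat_j :: quat where "quat_j = Quat 0 0 1 0"
definition quat_k :: quat where "quat_k = Quat 0 0 0 1"

lemma quat_units:
  "quat_i * quat_i = - 1" "quat_j * quat_j = - 1" "quat_k * quat_k = - 1"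
  "quat_i * quat_j * quat_k = - 1" "quat_i * quat_j = quat_k" "quat_j * quat_i = - quat_k"
  by (simp_all add: quat_i_def quat_j_def quat_k_def times_quat_def uminus_quat_def one_quat_def)

definition quat_comp :: "quat \<Rightarrow> nat \<Rightarrow> real" where
  "quat_comp x n =
     (if n = 0 then quat_re x else if n = 1 then quat_im1 x
      else if n = 2 then quat_im2 x else quat_im3 x)"

lemma quat_eq_components:
  "x = of_real (quat_comp x 0) + quat_i * of_real (quat_comp x 1)
       + quat_j * of_real (quat_comp x 2) + quat_k * of_real (quat_comp x 3)"
  by (cases x) (simp add: quat_comp_def quat_i_def quat_j_def quat_k_def of_real_def
      scaleR_quat_def one_quat_def plus_quat_def times_quat_def)


section \<open>Semi-definite positive quintuples\<close>

definition semi_definite_positive ::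
    "real \<Rightarrow> real \<times> real \<times> real \<times> real \<times> real \<Rightarrow> bool" where
  "semi_definite_positive \<epsilon> = (\<lambda>(p, q, r, s, l).
     p > 0 \<and> l > 0 \<and>
     (Max {q, r, s} \<ge> sqrt (l + \<epsilon>) \<or>
      0 \<le> Min {q, r, s} \<and> Min {q, r, s} \<le> Max {q, r, s} \<and> Max {q, r, s} \<le> sqrt (l + \<epsilon>) \<and>
      q\<^sup>2 + r\<^sup>2 + s\<^sup>2 \<ge> l + \<epsilon>))"


section \<open>The coefficient quintuples of the Riccati equation\<close>

text \<open>
  The functions below act on the values \<open>a(t)\<close>, \<open>b(t)\<close>, \<open>c(t)\<close>, \<open>d(t)\<close> of the coefficients.
  For \<open>m = 1, 2, 3\<close>, \<open>p_{n,m}\<close> is \<open>b_m + c_m\<close> when \<open>n = 0\<close> or \<open>n = m\<close>, and \<open>b_m - c_m\<close> otherwise.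
\<close>

definition riccati_p :: "nat \<Rightarrow> nat \<Rightarrow> quat \<Rightarrow> quat \<Rightarrow> real" where
  "riccati_p n m b c =
     (if n = 0 \<or> n = m then quat_comp b m + quat_comp c m else quat_comp b m - quat_comp c m)"

text \<open>The sign of the product \<open>a_n d_n\<close> is opposite for \<open>n = 0\<close> and for \<open>n = 1, 2, 3\<close>.\<close>

definition riccati_D :: "nat \<Rightarrow> quat \<Rightarrow> quat \<Rightarrow> quat \<Rightarrow> quat \<Rightarrow> real" where
  "riccati_D n a b c d =
     (if n = 0 then
        (if quat_comp a 0 \<noteq> 0
         then (\<Sum>m=1..3. (riccati_p 0 m b c)\<^sup>2) + 4 * quat_comp a 0 * quat_comp d 0
         else 4 * quat_comp d 0)
      else
        (if quat_comp a n \<noteq> 0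
         then (\<Sum>m=1..3. (riccati_p n m b c)\<^sup>2) - 4 * quat_comp a n * quat_comp d n
         else - 4 * quat_comp d n))"

definition riccati_L0 ::
    "quat \<Rightarrow> quat \<Rightarrow> quat \<Rightarrow> quat \<Rightarrow> real \<times> real \<times> real \<times> real \<times> real" where
  "riccati_L0 a b c d =
     (quat_comp a 0, - quat_comp b 1 - quat_comp c 1, - quat_comp b 2 - quat_comp c 2,
      - quat_comp b 3 - quat_comp c 3, riccati_D 0 a b c d)"

definition riccati_L1 ::
    "quat \<Rightarrow> quat \<Rightarrow> quat \<Rightarrow> quat \<Rightarrow> real \<times> real \<times> real \<times> real \<times> real" where
  "riccati_L1 a b c d =
     (quat_comp a 1, quat_comp b 1 + quat_comp c 1, - quat_comp b 2 + quat_comp c 2,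
      quat_comp b 3 - quat_comp c 3, riccati_D 1 a b c d)"

definition riccati_L2 ::
    "quat \<Rightarrow> quat \<Rightarrow> quat \<Rightarrow> quat \<Rightarrow> real \<times> real \<times> real \<times> real \<times> real" where
  "riccati_L2 a b c d =
     (quat_comp a 2, quat_comp b 1 - quat_comp c 1, quat_comp b 2 + quat_comp c 2,
      - quat_comp b 3 + quat_comp c 3, riccati_D 2 a b c d)"

definition riccati_L3 ::
    "quat \<Rightarrow> quat \<Rightarrow> quat \<Rightarrow> quat \<Rightarrow> real \<times> real \<times> real \<times> real \<times> real" where
  "riccati_L3 a b c d =
     (quat_comp a 3, - quat_comp b 1 + quat_comp c 1, quat_comp b 2 - quat_comp c 2,
      quat_comp b 3 + quat_comp c 3, riccati_D 3 a b c d)"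


section \<open>Solutions of the Riccati equation\<close>

text \<open>
  A continuously differentiable solution on \<open>[t0, \<infinity>)\<close>; the derivative at \<open>t0\<close> is one-sided.
\<close>

definition riccati_solution ::
    "(real \<Rightarrow> quat) \<Rightarrow> (real \<Rightarrow> quat) \<Rightarrow> (real \<Rightarrow> quat) \<Rightarrow> (real \<Rightarrow> quat) \<Rightarrow> real
      \<Rightarrow> (real \<Rightarrow> quat) \<Rightarrow> bool" where
  "riccati_solution a b c d t0 q \<longleftrightarrow>
     (\<exists>q'. continuous_on {t0..} q' \<and>
        (\<forall>t\<ge>t0. (q has_vector_derivative q' t) (at t within {t0..}) \<and>
                 q' t + q t * a t * q t + b t * q t + q t * c t + d t = 0))"

end

theory Submission imports Defs begin

text \<open>
  Write the equation as \<open>Q' = F(t, Q)\<close> with \<open>F = - (QaQ + bQ + Qc + d)\<close>, and let \<open>q\<^sub>n\<close> be the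
  coordinates in \<open>Q = q\<^sub>0 - i q\<^sub>1 - j q\<^sub>2 - k q\<^sub>3\<close>. Two facts about the orthant of all \<open>Q\<close> with
  \<open>q\<^sub>n \<ge> 0\<close> make the theorem true.

  The field points strictly into the orthant (\<open>riccati_field_inward\<close>). On the face \<open>q\<^sub>n = 0\<close> the rate
  \<open>q\<^sub>n'\<close> is a quadratic polynomial in the other three coordinates. Its leading part is
  \<open>a\<^sub>n\<close> times the sum of their squares, its linear coefficients are the middle entries of the
  \<open>n\<close>-th quintuple, and its discriminant is the last entry \<open>D\<^sub>n\<close>. Completing the squares, the rate is
  positive exactly when a sum of three squares exceeds \<open>D\<^sub>n\<close>; semi-definite positivity guarantees
  this for nonnegative coordinates, with margin \<open>\<epsilon>\<close>.

  The field cannot blow up inside the orthant (\<open>inner_riccati_field_le\<close>). The inner product of \<open>Q\<close>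
  with the quadratic term is \<open>|Q|\<^sup>2 (a\<^sub>0 q\<^sub>0 + a\<^sub>1 q\<^sub>1 + a\<^sub>2 q\<^sub>2 + a\<^sub>3 q\<^sub>3) \<ge> 0\<close>, so the quadratic term only
  decreases \<open>|Q|\<close>, and what remains grows at most linearly.

  A continuation argument is avoided by truncation. The growth estimate gives an explicit a priori
  bound \<open>R(t)\<close> for \<open>|Q(t)|\<close>. The point \<open>Q\<close> in \<open>F(t, Q)\<close> is replaced by its projection to the ball of
  radius \<open>R(t)\<close>. The truncated field is Lipschitz in \<open>Q\<close> with a constant that is continuous in
  \<open>t\<close>, hence has a solution on all of \<open>[t\<^sub>0, \<infinity>)\<close> (\<open>global_picard_lindeloef\<close>). Inside the orthant the
  projection is multiplication by a positive scalar, so both facts survive the truncation, and the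
  resulting bound \<open>|Q(t)| \<le> R(t)\<close> shows that the truncation was never active.
\<close>

section \<open>Global solutions for time-dependent Lipschitz fields\<close>

text \<open>
  Derivatives within \<open>[t\<^sub>0, \<infinity>)\<close> do not depend on a right end point beyond the given time, so the
  fundamental theorem on compact intervals carries over.
\<close>

lemma integral_has_vector_derivative_Ici:
  fixes g :: "real \<Rightarrow> 'a::banach"
  assumes g: "continuous_on {t0..} g" and t: "t0 \<le> t"
  shows "((\<lambda>u. integral {t0..u} g) has_vector_derivative g t) (at t within {t0..})"
proof -
  have "continuous_on {t0..t+1} g"
    by (rule continuous_on_subset[OF g]) auto
  then have "((\<lambda>u. integral {t0..u} g) has_vector_derivative g t) (at t within {t0..t+1})"
    by (rule integral_has_vector_derivative) (use t in auto)
  moreover have "at t within {t0..t+1} = at t within {t0..}"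
    by (rule at_within_nhd[where S = "{..<t+1}"]) auto
  ultimately show ?thesis by simp
qed

lemma has_vector_derivative_Ici_imp_continuous_on:
  fixes g :: "real \<Rightarrow> 'a::real_normed_vector"
  assumes "\<And>t. t0 \<le> t \<Longrightarrow> (g has_vector_derivative g' t) (at t within {t0..})"
  shows "continuous_on {t0..} g"
  unfolding continuous_on_eq_continuous_within
  using assms has_vector_derivative_continuous by fastforce

text \<open>
  The Picard operator is a contraction for a weighted supremum norm, with a weight \<open>w\<close> that satisfies
  \<open>w' = 2 k w\<close> for a bound \<open>k\<close> of the Lipschitz constant. Writing \<open>x = x\<^sub>0 + w y\<close> turns this norm into
  the ordinary one on bounded continuous functions \<open>y\<close>, and one application of Banach's theorem gives
  the solution on the whole half-line.
\<close>

lemma global_picard_lindeloef: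
  fixes f :: "real \<Rightarrow> 'a::banach \<Rightarrow> 'a" and K :: "real \<Rightarrow> real" and x0 :: 'a
  assumes f: "continuous_on ({t0..} \<times> UNIV) (\<lambda>(t, x). f t x)"
    and K: "continuous_on {t0..} K"
    and lip: "\<And>t x y. t0 \<le> t \<Longrightarrow> norm (f t x - f t y) \<le> K t * norm (x - y)"
  shows "\<exists>x. x t0 = x0 \<and> (\<forall>t\<ge>t0. (x has_vector_derivative f t (x t)) (at t within {t0..}))"
proof -
  have f_along: "continuous_on {t0..} (\<lambda>t. f t (x t))" if "continuous_on {t0..} x" for x
  proof -
    have "continuous_on {t0..} (\<lambda>t. (t, x t))" by (intro continuous_intros that)
    from continuous_on_compose2[OF f this] show ?thesis by auto
  qed
  \<comment> \<open>The summand \<open>norm (f t x0)\<close> ensures that the operator maps bounded functions to bounded ones.\<close>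
  define k where "k t = \<bar>K t\<bar> + norm (f t x0)" for t
  define w where "w t = exp (2 * integral {t0..t} k)" for t
  have k_cont: "continuous_on {t0..} k"
    unfolding k_def by (intro continuous_intros K f_along)
  have k_nonneg: "0 \<le> k t" for t by (simp add: k_def)
  have w_deriv: "(w has_vector_derivative 2 * (k t * w t)) (at t within {t0..})" if "t0 \<le> t" for t
    using integral_has_vector_derivative_Ici[OF k_cont that] unfolding w_def
    by (auto simp flip: has_real_derivative_iff_has_vector_derivative
        intro!: derivative_eq_intros)
  have w_cont: "continuous_on {t0..} w"
    by (rule has_vector_derivative_Ici_imp_continuous_on) (rule w_deriv)
  have w_pos: "0 < w t" for t by (simp add: w_def)
  have w_start: "w t0 = 1" by (simp add: w_def)
  have w_ge1: "1 \<le> w t" if "t0 \<le> t" for t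
    unfolding w_def using k_nonneg by (simp add: Henstock_Kurzweil_Integration.integral_nonneg
        integrable_continuous_real continuous_on_subset[OF k_cont])
  \<comment> \<open>The weight grows so fast that integrating against \<open>k\<close> costs a factor \<open>1/2\<close>.\<close>
  have weighted: "norm (integral {t0..t} g) \<le> B / 2 * w t"
    if g: "continuous_on {t0..} g" and le: "\<And>s. t0 \<le> s \<Longrightarrow> norm (g s) \<le> B * (k s * w s)"
      and B: "0 \<le> B" and t: "t0 \<le> t" for g :: "real \<Rightarrow> 'a" and B t
  proof -
    have "((\<lambda>s. 2 * (k s * w s)) has_integral (w t - w t0)) {t0..t}"
      by (rule fundamental_theorem_of_calculus[OF t])
         (auto intro: has_vector_derivative_within_subset[OF w_deriv])
    from has_integral_mult_right[OF this, of "B / 2"]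
    have I: "((\<lambda>s. B * (k s * w s)) has_integral (B / 2 * (w t - 1))) {t0..t}"
      by (simp add: w_start)
    have "norm (integral {t0..t} g) \<le> integral {t0..t} (\<lambda>s. B * (k s * w s))"
      by (rule integral_norm_bound_integral)
         (use I le continuous_on_subset[OF g] in \<open>auto intro: integrable_continuous_real\<close>)
    also have "\<dots> = B / 2 * (w t - 1)" using I by (rule integral_unique)
    also have "\<dots> \<le> B / 2 * w t" using B by (intro mult_left_mono) auto
    finally show ?thesis .
  qed
  define X where "X y t = x0 + w t *\<^sub>R apply_bcontfun y t" for y :: "real \<Rightarrow>\<^sub>C 'a" and t
  define J where "J y t = integral {t0..t} (\<lambda>s. f s (X y s))" for y t
  \<comment> \<open>Elements of the Banach space live on the whole line, so the values are frozen to the left of \<open>t0\<close>.\<close>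
  define T where "T y = Bcontfun (\<lambda>t. J y (max t0 t) /\<^sub>R w (max t0 t))" for y
  have X_cont: "continuous_on {t0..} (X y)" for y
    unfolding X_def by (intro continuous_intros w_cont continuous_on_apply_bcontfun)
  have fX_cont: "continuous_on {t0..} (\<lambda>s. f s (X y s))" for y
    by (rule f_along[OF X_cont])
  have J_deriv: "(J y has_vector_derivative f t (X y t)) (at t within {t0..})" if "t0 \<le> t" for y t
    using integral_has_vector_derivative_Ici[OF fX_cont that] by (simp add: J_def[abs_def])
  have J_cont: "continuous_on {t0..} (J y)" for y
    by (rule has_vector_derivative_Ici_imp_continuous_on) (rule J_deriv)
  have lip': "norm (f t x - f t y) \<le> k t * norm (x - y)" if "t0 \<le> t" for t x y
  proof -
    have "K t \<le> k t" by (simp add: k_def add_increasing2)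
    then show ?thesis using lip[OF that, of x y] by (meson mult_right_mono norm_ge_zero order_trans)
  qed
  have J_bound: "norm (J y t) \<le> (1 + norm y) / 2 * w t" if t: "t0 \<le> t" for y t
    unfolding J_def
  proof (rule weighted[OF fX_cont _ _ t])
    fix s assume s: "t0 \<le> s"
    have "norm (f s (X y s)) \<le> norm (f s x0) + norm (f s (X y s) - f s x0)"
      by (metis add.commute diff_add_cancel norm_triangle_ineq)
    also have "\<dots> \<le> k s + k s * (w s * norm (apply_bcontfun y s))"
      using lip'[OF s, of "X y s" x0] w_pos[of s] by (simp add: X_def k_def)
    also have "\<dots> \<le> k s * w s + k s * (w s * norm y)"
      using w_ge1[OF s] k_nonneg[of s] w_pos[of s]
      by (intro add_mono mult_left_mono norm_bounded) (auto simp: mult_le_cancel_left1 less_eq_real_def)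
    finally show "norm (f s (X y s)) \<le> (1 + norm y) * (k s * w s)" by (simp add: algebra_simps)
  qed auto
  have T_apply: "apply_bcontfun (T y) t = J y (max t0 t) /\<^sub>R w (max t0 t)" for y t
  proof -
    have "continuous_on UNIV (\<lambda>t. J y (max t0 t) /\<^sub>R w (max t0 t))"
      by (intro continuous_intros continuous_on_compose2[OF J_cont] continuous_on_compose2[OF w_cont])
         (use w_pos in \<open>auto simp: less_imp_neq[symmetric]\<close>)
    moreover have "norm (J y (max t0 t) /\<^sub>R w (max t0 t)) \<le> (1 + norm y) / 2" for t
      using J_bound[of "max t0 t" y] w_pos[of "max t0 t"]
      by (simp add: divide_simps mult.commute)
    ultimately have "(\<lambda>t. J y (max t0 t) /\<^sub>R w (max t0 t)) \<in> bcontfun"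
      unfolding bcontfun_def bounded_iff by blast
    then show ?thesis by (simp add: T_def Bcontfun_inverse)
  qed
  have T_contraction: "dist (T y) (T z) \<le> 1 / 2 * dist y z" for y z
  proof (rule dist_bound)
    fix t
    let ?u = "max t0 t"
    have int: "(\<lambda>s. f s (X v s)) integrable_on {t0..?u}" for v
      by (intro integrable_continuous_real continuous_on_subset[OF fX_cont]) auto
    have "norm (integral {t0..?u} (\<lambda>s. f s (X y s) - f s (X z s))) \<le> dist y z / 2 * w ?u"
    proof (rule weighted)
      fix s assume s: "t0 \<le> s"
      have "norm (f s (X y s) - f s (X z s)) \<le> k s * norm (X y s - X z s)" by (rule lip'[OF s])
      also have "norm (X y s - X z s) = w s * dist (apply_bcontfun y s) (apply_bcontfun z s)"
        using w_pos[of s] by (simp add: X_def dist_norm flip: scaleR_diff_right)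
      also have "k s * \<dots> \<le> k s * (w s * dist y z)"
        using k_nonneg[of s] w_pos[of s] by (intro mult_left_mono dist_bounded) auto
      finally show "norm (f s (X y s) - f s (X z s)) \<le> dist y z * (k s * w s)"
        by (simp add: mult_ac)
    qed (auto intro!: continuous_intros fX_cont)
    then have "norm (J y ?u - J z ?u) \<le> dist y z / 2 * w ?u"
      by (simp add: J_def integral_diff[OF int int])
    then show "dist (apply_bcontfun (T y) t) (apply_bcontfun (T z) t) \<le> 1 / 2 * dist y z"
      using w_pos[of ?u] by (simp add: T_apply dist_norm divide_simps mult.commute flip: scaleR_diff_right)
  qed
  obtain y where y: "T y = y"
    using banach_fix_type[of "1/2" T] T_contraction by auto
  have X_eq: "X y t = x0 + J y t" if "t0 \<le> t" for t
    using T_apply[of y t] that w_pos[of t] by (simp add: y X_def max_absorb2)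
  have "(X y has_vector_derivative f t (X y t)) (at t within {t0..})" if t: "t0 \<le> t" for t
  proof (rule has_vector_derivative_transform[where f = "\<lambda>t. x0 + J y t"])
    show "((\<lambda>t. x0 + J y t) has_vector_derivative f t (X y t)) (at t within {t0..})"
      using J_deriv[OF t] by (auto intro!: derivative_eq_intros)
  qed (use t X_eq in auto)
  moreover have "X y t0 = x0" using X_eq[of t0] by (simp add: J_def)
  ultimately show ?thesis by blast
qed

section \<open>Differential inequalities\<close>

text \<open>
  Consider the first time at which some coordinate vanishes. There all coordinates are still
  nonnegative, so the vanishing one has a positive derivative, although it reaches \<open>0\<close> from above.
\<close>

lemma positive_if_inward_derivative:
  fixes u u' :: "'i \<Rightarrow> real \<Rightarrow> real"
  assumes I: "finite I"
    and deriv: "\<And>i t. i \<in> I \<Longrightarrow> t0 \<le> t \<Longrightarrow> (u i has_real_derivative u' i t) (at t within {t0..})"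
    and start: "\<And>i. i \<in> I \<Longrightarrow> 0 < u i t0"
    and inward: "\<And>i t. i \<in> I \<Longrightarrow> t0 \<le> t \<Longrightarrow> u i t = 0 \<Longrightarrow> (\<And>j. j \<in> I \<Longrightarrow> 0 \<le> u j t) \<Longrightarrow> 0 < u' i t"
    and "i \<in> I" "t0 \<le> t"
  shows "0 < u i t"
proof (rule ccontr)
  assume "\<not> 0 < u i t"
  define S where "S = (\<Union>i\<in>I. {t\<in>{t0..}. u i t \<le> 0})"
  have cont: "continuous_on {t0..} (u i)" if "i \<in> I" for i
    using deriv[OF that] DERIV_continuous unfolding continuous_on_eq_continuous_within by fastforce
  have "closed S" unfolding S_def
    by (intro closed_UN I ballI continuous_on_closed_Collect_le cont continuous_on_const closed_atLeast)
  moreover have S_ne: "S \<noteq> {}" and S_bdd: "bdd_below S"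
    using assms \<open>\<not> 0 < u i t\<close> by (auto simp: S_def not_less intro!: bdd_belowI[of _ t0])
  ultimately have "Inf S \<in> S" by (intro closed_contains_Inf)
  then obtain j where j: "j \<in> I" "t0 \<le> Inf S" "u j (Inf S) \<le> 0" by (auto simp: S_def)
  define s where "s = Inf S"
  have s: "t0 < s" using start[OF j(1)] j by (cases "t0 = s") (auto simp: s_def)
  have before: "0 < u m r" if "m \<in> I" "t0 \<le> r" "r < s" for m r
    using that cInf_lower[OF _ S_bdd, of r] by (force simp: S_def s_def)
  have nonneg: "0 \<le> u m s" if m: "m \<in> I" for m
  proof (rule tendsto_lowerbound)
    show "(u m \<longlongrightarrow> u m s) (at s within {t0..<s})"
      by (rule tendsto_within_subset[where S = "{t0..}"])
         (use cont[OF m] s in \<open>auto simp: continuous_on_def\<close>)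
    show "\<forall>\<^sub>F r in at s within {t0..<s}. 0 \<le> u m r"
      using before[OF m] by (auto simp: eventually_at_filter intro!: always_eventually less_imp_le)
    show "at s within {t0..<s} \<noteq> bot" using s by (simp add: trivial_limit_within islimpt_Ico)
  qed
  have "u j s = 0" using nonneg[OF j(1)] j(3) by (simp add: s_def)
  then have "0 < u' j s" using inward[OF j(1)] nonneg s by auto
  then obtain \<delta> where \<delta>: "\<delta> > 0" "\<And>h. 0 < h \<Longrightarrow> s - h \<in> {t0..} \<Longrightarrow> h < \<delta> \<Longrightarrow> u j (s - h) < u j s"
    using has_real_derivative_pos_inc_left[OF deriv[OF j(1)], of s] s by (metis less_imp_le)
  define h where "h = min (\<delta> / 2) (s - t0)"
  have "0 < h" "h < \<delta>" "t0 \<le> s - h" using \<delta>(1) s by (auto simp: h_def)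
  then show False using \<delta>(2)[of h] before[OF j(1), of "s - h"] \<open>u j s = 0\<close> by auto
qed

text \<open>
  Multiplying \<open>u\<close> by the integrating factor \<open>exp (- \<integral> C)\<close> makes it nonincreasing.
\<close>

lemma gronwall_Ici:
  fixes u u' C :: "real \<Rightarrow> real"
  assumes C: "continuous_on {t0..} C"
    and u: "\<And>t. t0 \<le> t \<Longrightarrow> (u has_real_derivative u' t) (at t within {t0..})"
    and le: "\<And>t. t0 \<le> t \<Longrightarrow> u' t \<le> C t * u t"
    and t: "t0 \<le> t"
  shows "u t \<le> u t0 * exp (integral {t0..t} C)"
proof -
  define v where "v s = u s * exp (- integral {t0..s} C)" for s
  have v: "(v has_real_derivative (u' s - C s * u s) * exp (- integral {t0..s} C)) (at s within {t0..})"
    if "t0 \<le> s" for s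
    using integral_has_vector_derivative_Ici[OF C that] u[OF that] unfolding v_def
    by (auto simp: algebra_simps simp flip: has_real_derivative_iff_has_vector_derivative
        intro!: derivative_eq_intros)
  have "v t \<le> v t0"
  proof -
    have "(v has_derivative (\<lambda>h. (u' s - C s * u s) * exp (- integral {t0..s} C) * h))
        (at s within {t0..t})" if "t0 \<le> s" "s \<le> t" for s
      using has_field_derivative_subset[OF v[OF that(1)], of "{t0..t}"]
      by (auto simp: has_field_derivative_def)
    from mvt_very_simple[OF t this] obtain s where "s \<in> {t0..t}"
      and "v t - v t0 = (u' s - C s * u s) * exp (- integral {t0..s} C) * (t - t0)" by auto
    moreover from this have "(u' s - C s * u s) * exp (- integral {t0..s} C) * (t - t0) \<le> 0"
      using le[of s] t by (intro mult_nonpos_nonneg) auto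
    ultimately show ?thesis by simp
  qed
  then show ?thesis by (simp add: v_def exp_minus field_simps)
qed


section \<open>The radial retraction onto a ball\<close>

text \<open>
  In an inner product space this is the nearest-point projection onto the closed ball of radius
  \<open>R > 0\<close>. The formula without case distinction makes joint continuity in \<open>R\<close> and \<open>x\<close> evident.
\<close>

definition radial_retraction :: "real \<Rightarrow> 'a::real_normed_vector \<Rightarrow> 'a" where
  "radial_retraction R x = (R / max R (norm x)) *\<^sub>R x"

lemma norm_radial_retraction_le:
  assumes "0 < R" shows "norm (radial_retraction R x) \<le> R"
  using assms by (auto simp: radial_retraction_def max_def)

lemma radial_retraction_inside:
  assumes "0 < R" "norm x \<le> R" shows "radial_retraction R x = x"
  using assms by (simp add: radial_retraction_def max_def)

lemma radial_retraction_scales: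
  assumes "0 < R" obtains r where "0 < r" "r \<le> 1" "radial_retraction R x = r *\<^sub>R x"
proof
  show "0 < R / max R (norm x)" "R / max R (norm x) \<le> 1" using assms by auto
qed (simp add: radial_retraction_def)

text \<open>
  The variational characterisation of the nearest-point projection: seen from the image of \<open>x\<close>, every
  point of the ball makes an obtuse angle with \<open>x\<close>.
\<close>

lemma radial_retraction_obtuse:
  fixes x z :: "'a::real_inner"
  assumes R: "0 < R" and z: "norm z \<le> R"
  shows "(x - radial_retraction R x) \<bullet> (z - radial_retraction R x) \<le> 0"
proof (cases "norm x \<le> R")
  case False
  then have nx: "0 < norm x" "R < norm x" using R by auto
  then have r: "radial_retraction R x = (R / norm x) *\<^sub>R x"
    by (simp add: radial_retraction_def max_def)
  have "x \<bullet> z \<le> norm x * R"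
    using norm_cauchy_schwarz[of x z] z by (meson mult_left_mono norm_ge_zero order_trans)
  also have "norm x * R = x \<bullet> radial_retraction R x"
    using nx by (simp add: r power2_norm_eq_inner[symmetric] power2_eq_square)
  finally have "x \<bullet> (z - radial_retraction R x) \<le> 0" by (simp add: inner_diff_right)
  then have "(1 - R / norm x) * (x \<bullet> (z - radial_retraction R x)) \<le> 0"
    using nx by (intro mult_nonneg_nonpos) auto
  moreover have "x - radial_retraction R x = (1 - R / norm x) *\<^sub>R x"
    by (simp add: r scaleR_diff_left)
  ultimately show ?thesis by simp
qed (simp add: radial_retraction_inside[OF R])

text \<open>
  Adding the obtuse-angle inequalities at \<open>x\<close> and at \<open>y\<close> gives
  \<open>|p - q|\<^sup>2 \<le> (x - y) \<bullet> (p - q)\<close> for the two images \<open>p\<close> and \<open>q\<close>.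
\<close>

lemma radial_retraction_nonexpansive:
  fixes x y :: "'a::real_inner"
  assumes R: "0 < R"
  shows "norm (radial_retraction R x - radial_retraction R y) \<le> norm (x - y)"
proof -
  let ?p = "radial_retraction R x" and ?q = "radial_retraction R y"
  have "(norm (?p - ?q))\<^sup>2 = (?p - ?q) \<bullet> (?p - ?q)" by (rule power2_norm_eq_inner)
  also have "\<dots> \<le> (x - y) \<bullet> (?p - ?q)"
    using radial_retraction_obtuse[OF R norm_radial_retraction_le[OF R, of y], of x]
      radial_retraction_obtuse[OF R norm_radial_retraction_le[OF R, of x], of y]
    by (simp add: inner_diff_left inner_diff_right inner_commute)
  also have "\<dots> \<le> norm (x - y) * norm (?p - ?q)" by (rule norm_cauchy_schwarz)
  finally show ?thesis
    by (cases "norm (?p - ?q) = 0") (auto simp: power2_eq_square)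
qed

section \<open>Quaternions in conjugate coordinates\<close>

text \<open>
  As a finite-dimensional space the quaternions are complete, which the fixed-point argument needs.
\<close>

instantiation quat :: euclidean_space
begin

definition Basis_quat :: "quat set" where "Basis = {1, quat_i, quat_j, quat_k}"

instance
  by standard
    (auto simp: Basis_quat_def inner_quat_def one_quat_def zero_quat_def quat_i_def quat_j_def
      quat_k_def intro: quat.expand)

end

text \<open>
  The functions \<open>q\<^sub>n\<close> in \<open>q\<^sub>0 - i q\<^sub>1 - j q\<^sub>2 - k q\<^sub>3\<close>. With this sign convention the invariant region is
  the positive orthant.
\<close>

definition conj_coord :: "nat \<Rightarrow> quat \<Rightarrow> real" where
  "conj_coord n x = (if n = 0 then quat_comp x 0 else - quat_comp x n)"

lemma bounded_linear_conj_coord: "bounded_linear (conj_coord n)"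
proof -
  have "conj_coord n = (\<lambda>x. x \<bullet> (if n = 0 then 1 else if n = 1 then - quat_i
      else if n = 2 then - quat_j else - quat_k))"
    by (auto simp: conj_coord_def quat_comp_def inner_quat_def one_quat_def uminus_quat_def
        quat_i_def quat_j_def quat_k_def)
  then show ?thesis by (simp add: bounded_linear_inner_left)
qed

lemma quat_eq_conj_coords:
  "x = of_real (conj_coord 0 x) - quat_i * of_real (conj_coord 1 x)
       - quat_j * of_real (conj_coord 2 x) - quat_k * of_real (conj_coord 3 x)"
  by (subst quat_eq_components[of x]) (simp add: conj_coord_def)

lemma le_3_cases:
  fixes n :: nat assumes "n \<le> 3" obtains "n = 0" | "n = 1" | "n = 2" | "n = 3"
  using assms by linarith

section \<open>The Riccati vector field\<close>

definition riccati_field :: "quat \<Rightarrow> quat \<Rightarrow> quat \<Rightarrow> quat \<Rightarrow> quat \<Rightarrow> quat" where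
  "riccati_field a b c d x = - (x * a * x + b * x + x * c + d)"

text \<open>
  The quadratic terms differ by \<open>x a (x - y) + (x - y) a y\<close>, so their Lipschitz constant on a ball is
  proportional to its radius.
\<close>

lemma norm_riccati_field_diff_le:
  assumes x: "norm x \<le> R" and y: "norm y \<le> R"
  shows "norm (riccati_field a b c d x - riccati_field a b c d y)
    \<le> (2 * R * norm a + norm b + norm c) * norm (x - y)"
proof -
  have R: "0 \<le> R" using x norm_ge_zero order_trans by blast
  have "riccati_field a b c d x - riccati_field a b c d y
      = - (x * a * (x - y) + (x - y) * a * y + b * (x - y) + (x - y) * c)"
    by (simp add: riccati_field_def algebra_simps)
  then have "norm (riccati_field a b c d x - riccati_field a b c d y)
      \<le> norm (x * a * (x - y)) + norm ((x - y) * a * y) + norm (b * (x - y)) + norm ((x - y) * c)"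
    by (simp only: norm_minus_cancel) (intro norm_triangle_mono order_refl)
  also have "\<dots> \<le> R * norm a * norm (x - y) + norm (x - y) * norm a * R
      + norm b * norm (x - y) + norm (x - y) * norm c"
    unfolding norm_mult_quat using x y R by (intro add_mono mult_mono) auto
  also have "\<dots> = (2 * R * norm a + norm b + norm c) * norm (x - y)" by (simp add: algebra_simps)
  finally show ?thesis .
qed

text \<open>
  Let \<open>l = q\<^sup>2 + r\<^sup>2 + s\<^sup>2 - 4 p e\<close>. Multiplied by \<open>4 p\<close>, the polynomial becomes
  \<open>(2 p x + q)\<^sup>2 + (2 p y + r)\<^sup>2 + (2 p z + s)\<^sup>2 - l\<close>. Semi-definite positivity offers two reasons
  why the sum of squares is at least \<open>l + \<epsilon>\<close> on the orthant: either one of \<open>q, r, s\<close> is at least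
  \<open>sqrt (l + \<epsilon>)\<close>, and the corresponding square alone suffices, or all three are nonnegative,
  so that every square is at least its value at \<open>0\<close>.
\<close>

lemma semi_definite_positive_rate:
  assumes "semi_definite_positive \<epsilon> (p, q, r, s, q\<^sup>2 + r\<^sup>2 + s\<^sup>2 - 4 * p * e)"
    and \<epsilon>: "0 < \<epsilon>" and nonneg: "0 \<le> x" "0 \<le> y" "0 \<le> z"
  shows "0 < p * (x\<^sup>2 + y\<^sup>2 + z\<^sup>2) + q * x + r * y + s * z + e"
proof -
  define l where "l = q\<^sup>2 + r\<^sup>2 + s\<^sup>2 - 4 * p * e"
  have p: "0 < p" and l: "0 < l"
    and alt: "(sqrt (l + \<epsilon>) \<le> q \<or> sqrt (l + \<epsilon>) \<le> r \<or> sqrt (l + \<epsilon>) \<le> s)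
      \<or> (0 \<le> q \<and> 0 \<le> r \<and> 0 \<le> s \<and> l + \<epsilon> \<le> q\<^sup>2 + r\<^sup>2 + s\<^sup>2)"
    using assms(1) by (auto simp: semi_definite_positive_def l_def max_def min_def split: if_splits)
  have shift: "l + \<epsilon> \<le> (2 * p * h + g)\<^sup>2" if "sqrt (l + \<epsilon>) \<le> g" "0 \<le> h" for g h
  proof -
    have "sqrt (l + \<epsilon>) \<le> 2 * p * h + g" using that p by (simp add: add_increasing)
    then show ?thesis using l \<epsilon> real_sqrt_ge_zero[of "l + \<epsilon>"]
      by (simp add: real_le_lsqrt sqrt_le_D)
  qed
  have grow: "g\<^sup>2 \<le> (2 * p * h + g)\<^sup>2" if "0 \<le> g" "0 \<le> h" for g h
    using that p by (intro power_mono) auto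
  have "l + \<epsilon> \<le> (2 * p * x + q)\<^sup>2 + (2 * p * y + r)\<^sup>2 + (2 * p * z + s)\<^sup>2"
    using alt shift[of q x] shift[of r y] shift[of s z] grow[of q x] grow[of r y] grow[of s z] nonneg
      zero_le_power2[of "2 * p * x + q"] zero_le_power2[of "2 * p * y + r"]
      zero_le_power2[of "2 * p * z + s"]
    by argo
  also have "\<dots> = l + 4 * p * (p * (x\<^sup>2 + y\<^sup>2 + z\<^sup>2) + q * x + r * y + s * z + e)"
    by (simp add: l_def power2_eq_square algebra_simps)
  finally have "0 < 4 * p * (p * (x\<^sup>2 + y\<^sup>2 + z\<^sup>2) + q * x + r * y + s * z + e)"
    using \<epsilon> by linarith
  then show ?thesis using p by (simp add: zero_less_mult_iff)
qed

text \<open>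
  On the face \<open>conj_coord n x = 0\<close> the \<open>n\<close>-th coordinate of the field is the polynomial of the
  previous lemma, with \<open>p, q, r, s\<close> the first four entries of the \<open>n\<close>-th quintuple. The constant term
  \<open>e\<close> is \<open>-d\<^sub>0\<close> for \<open>n = 0\<close> and \<open>d\<^sub>n\<close> otherwise, because the coordinates \<open>n \<ge> 1\<close> carry the
  opposite sign; this also explains the sign change of \<open>a\<^sub>n d\<^sub>n\<close> between \<open>D\<^sub>0\<close> and the other \<open>D\<^sub>n\<close>.
  The noncommutative cross terms decide in which order the remaining coordinates pair with
  \<open>q, r, s\<close>.
\<close>

lemma riccati_field_inward:
  assumes "semi_definite_positive \<epsilon> (riccati_L0 a b c d)"
    and "semi_definite_positive \<epsilon> (riccati_L1 a b c d)"
    and "semi_definite_positive \<epsilon> (riccati_L2 a b c d)"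
    and "semi_definite_positive \<epsilon> (riccati_L3 a b c d)"
    and \<epsilon>: "0 < \<epsilon>" and n: "n \<le> 3"
    and nonneg: "\<And>m. m \<le> 3 \<Longrightarrow> 0 \<le> conj_coord m x" and zero: "conj_coord n x = 0"
  shows "0 < conj_coord n (riccati_field a b c d x)"
proof -
  have x: "0 \<le> quat_re x" "0 \<le> - quat_im1 x" "0 \<le> - quat_im2 x" "0 \<le> - quat_im3 x"
    using nonneg[of 0] nonneg[of 1] nonneg[of 2] nonneg[of 3]
    by (auto simp: conj_coord_def quat_comp_def)
  note sums = riccati_D_def riccati_p_def quat_comp_def sum.atLeast1_atMost_eq numeral_3_eq_3
  note comps = conj_coord_def quat_comp_def riccati_field_def times_quat_def plus_quat_def
    uminus_quat_def
  from n show ?thesis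
  proof (cases rule: le_3_cases)
    case 1
    have "semi_definite_positive \<epsilon>
      (quat_re a, - quat_im1 b - quat_im1 c, - quat_im2 b - quat_im2 c, - quat_im3 b - quat_im3 c,
       (- quat_im1 b - quat_im1 c)\<^sup>2 + (- quat_im2 b - quat_im2 c)\<^sup>2 + (- quat_im3 b - quat_im3 c)\<^sup>2
         - 4 * quat_re a * (- quat_re d))"
      using assms(1) by (auto simp: riccati_L0_def sums semi_definite_positive_def power2_eq_square algebra_simps)
    from semi_definite_positive_rate[OF this \<epsilon> x(2-4)] zero show ?thesis
      by (simp add: 1 comps power2_eq_square algebra_simps)
  next
    case 2
    have "semi_definite_positive \<epsilon>
      (quat_im1 a, quat_im1 b + quat_im1 c, - quat_im2 b + quat_im2 c, quat_im3 b - quat_im3 c,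
       (quat_im1 b + quat_im1 c)\<^sup>2 + (- quat_im2 b + quat_im2 c)\<^sup>2 + (quat_im3 b - quat_im3 c)\<^sup>2
         - 4 * quat_im1 a * quat_im1 d)"
      using assms(2) by (auto simp: riccati_L1_def sums semi_definite_positive_def power2_eq_square algebra_simps)
    from semi_definite_positive_rate[OF this \<epsilon> x(1) x(4) x(3)] zero show ?thesis
      by (simp add: 2 comps power2_eq_square algebra_simps)
  next
    case 3
    have "semi_definite_positive \<epsilon>
      (quat_im2 a, quat_im1 b - quat_im1 c, quat_im2 b + quat_im2 c, - quat_im3 b + quat_im3 c,
       (quat_im1 b - quat_im1 c)\<^sup>2 + (quat_im2 b + quat_im2 c)\<^sup>2 + (- quat_im3 b + quat_im3 c)\<^sup>2
         - 4 * quat_im2 a * quat_im2 d)"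
      using assms(3) by (auto simp: riccati_L2_def sums semi_definite_positive_def power2_eq_square algebra_simps)
    from semi_definite_positive_rate[OF this \<epsilon> x(4) x(1) x(2)] zero show ?thesis
      by (simp add: 3 comps power2_eq_square algebra_simps)
  next
    case 4
    have "semi_definite_positive \<epsilon>
      (quat_im3 a, - quat_im1 b + quat_im1 c, quat_im2 b - quat_im2 c, quat_im3 b + quat_im3 c,
       (- quat_im1 b + quat_im1 c)\<^sup>2 + (quat_im2 b - quat_im2 c)\<^sup>2 + (quat_im3 b + quat_im3 c)\<^sup>2
         - 4 * quat_im3 a * quat_im3 d)"
      using assms(4) by (auto simp: riccati_L3_def sums semi_definite_positive_def power2_eq_square algebra_simps)
    from semi_definite_positive_rate[OF this \<epsilon> x(3) x(2) x(1)] zero show ?thesis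
      by (simp add: 4 comps power2_eq_square algebra_simps)
  qed
qed

text \<open>
  The field is evaluated at the truncated point \<open>r x\<close> but paired with \<open>x\<close> itself, and the
  bound does not depend on \<open>r\<close>. Hence the radius of truncation can be chosen from this very bound.
  The quadratic term has the favourable sign because
  \<open>x \<bullet> (x a x) = |x|\<^sup>2 Re (a x)\<close>; the linear and constant terms are estimated by the
  Cauchy-Schwarz inequality.
\<close>

lemma inner_riccati_field_le:
  assumes a: "\<And>m. m \<le> 3 \<Longrightarrow> 0 < quat_comp a m"
    and x: "\<And>m. m \<le> 3 \<Longrightarrow> 0 \<le> conj_coord m x"
    and r: "0 < r" "r \<le> 1"
  shows "2 * (x \<bullet> riccati_field a b c d (r *\<^sub>R x))
    \<le> (2 * norm b + 2 * norm c + norm d) * ((norm x)\<^sup>2 + 1)"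
proof -
  let ?y = "r *\<^sub>R x"
  have "x \<bullet> (x * a * x) = (x \<bullet> x) * (\<Sum>m\<le>3. quat_comp a m * conj_coord m x)"
    by (simp add: inner_quat_def times_quat_def conj_coord_def quat_comp_def numeral_3_eq_3 algebra_simps)
  also have "\<dots> \<ge> 0"
    using a x by (intro mult_nonneg_nonneg sum_nonneg) (auto intro: less_imp_le)
  finally have quad: "0 \<le> x \<bullet> (?y * a * ?y)" by simp
  have y: "norm ?y \<le> norm x" using r by (simp add: mult_left_le_one_le)
  have cs: "- (x \<bullet> z) \<le> norm x * norm z" for z :: quat
    using norm_cauchy_schwarz[of x "- z"] by simp
  have "- (x \<bullet> (b * ?y)) \<le> norm b * (norm x)\<^sup>2"
    using cs[of "b * ?y"] mult_left_mono[OF y, of "norm x * norm b"]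
    by (simp add: norm_mult_quat power2_eq_square mult_ac)
  moreover have "- (x \<bullet> (?y * c)) \<le> norm c * (norm x)\<^sup>2"
    using cs[of "?y * c"] mult_left_mono[OF y, of "norm x * norm c"]
    by (simp add: norm_mult_quat power2_eq_square mult_ac)
  moreover have "- (2 * (x \<bullet> d)) \<le> norm d * ((norm x)\<^sup>2 + 1)"
  proof -
    have "2 * norm x \<le> (norm x)\<^sup>2 + 1" using zero_le_power2[of "norm x - 1"]
      by (simp add: power2_eq_square algebra_simps)
    from mult_left_mono[OF this, of "norm d"] show ?thesis using cs[of d] by (simp add: mult_ac)
  qed
  moreover have "2 * (x \<bullet> riccati_field a b c d ?y) = - (2 * (x \<bullet> (?y * a * ?y)))
      - 2 * (x \<bullet> (b * ?y)) - 2 * (x \<bullet> (?y * c)) - 2 * (x \<bullet> d)"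
    by (simp only: riccati_field_def inner_add_right inner_minus_right) simp
  ultimately have "2 * (x \<bullet> riccati_field a b c d ?y)
      \<le> 2 * (norm b * (norm x)\<^sup>2) + 2 * (norm c * (norm x)\<^sup>2) + norm d * ((norm x)\<^sup>2 + 1)"
    using quad by linarith
  also have "\<dots> \<le> (2 * norm b + 2 * norm c + norm d) * ((norm x)\<^sup>2 + 1)"
    by (simp add: algebra_simps)
  finally show ?thesis .
qed

theorem theorem3p2:
  fixes a b c d :: "real \<Rightarrow> quat" and t0 \<epsilon> :: real
  assumes "continuous_on {t0..} a" and "continuous_on {t0..} b"
    and "continuous_on {t0..} c" and "continuous_on {t0..} d"
    and "\<epsilon> > 0"
    and "\<forall>t\<ge>t0. semi_definite_positive \<epsilon> (riccati_L0 (a t) (b t) (c t) (d t))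
              \<and> semi_definite_positive \<epsilon> (riccati_L1 (a t) (b t) (c t) (d t))
              \<and> semi_definite_positive \<epsilon> (riccati_L2 (a t) (b t) (c t) (d t))
              \<and> semi_definite_positive \<epsilon> (riccati_L3 (a t) (b t) (c t) (d t))"
  shows "\<forall>\<gamma> :: nat \<Rightarrow> real. (\<forall>n\<le>3. \<gamma> n > 0) \<longrightarrow>
     (\<exists>q :: nat \<Rightarrow> real \<Rightarrow> real.
        riccati_solution a b c d t0
          (\<lambda>t. of_real (q 0 t) - quat_i * of_real (q 1 t)
                - quat_j * of_real (q 2 t) - quat_k * of_real (q 3 t)) \<and>
        (\<forall>n\<le>3. q n t0 = \<gamma> n) \<and>
        (\<forall>t\<ge>t0. \<forall>n\<le>3. q n t > 0))"
proof (intro allI impI)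
  fix \<gamma> :: "nat \<Rightarrow> real" assume \<gamma>: "\<forall>n\<le>3. \<gamma> n > 0"
  note coeff_cont = assms(1-4)
  define x0 where "x0 = Quat (\<gamma> 0) (- \<gamma> 1) (- \<gamma> 2) (- \<gamma> 3)"
  have x0: "conj_coord n x0 = \<gamma> n" if "n \<le> 3" for n
    using that by (cases rule: le_3_cases) (auto simp: x0_def conj_coord_def quat_comp_def)
  \<comment> \<open>The growth rate from \<open>inner_riccati_field_le\<close>; \<open>R\<close> is the bound on the norm that it yields.\<close>
  define C where "C t = 2 * norm (b t) + 2 * norm (c t) + norm (d t)" for t
  have C: "continuous_on {t0..} C" unfolding C_def by (intro continuous_intros coeff_cont)
  define R where "R t = sqrt (((norm x0)\<^sup>2 + 1) * exp (integral {t0..t} C))" for t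
  have R_cont: "continuous_on {t0..} R"
    unfolding R_def
    using has_vector_derivative_Ici_imp_continuous_on[OF integral_has_vector_derivative_Ici[OF C]]
    by (intro continuous_intros)
  have R_pos: "0 < R t" for t by (simp add: R_def add_nonneg_pos)
  \<comment> \<open>The truncated field.\<close>
  define F where "F t x = riccati_field (a t) (b t) (c t) (d t) (radial_retraction (R t) x)" for t x
  have "continuous_on ({t0..} \<times> UNIV) (\<lambda>(t, x). F t x)"
  proof -
    have 1: "continuous_on ({t0..} \<times> UNIV) (\<lambda>z. g (fst z))"
      if "continuous_on {t0..} g" for g :: "real \<Rightarrow> 'z::topological_space"
      by (rule continuous_on_compose2[OF that]) (auto intro: continuous_intros)
    have "max (R t) (norm x) \<noteq> 0" for t and x :: quat using R_pos[of t] by (auto simp: max_def)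
    then show ?thesis
      unfolding F_def riccati_field_def radial_retraction_def case_prod_beta
      by (intro continuous_intros 1 coeff_cont R_cont) auto
  qed
  moreover have "continuous_on {t0..} (\<lambda>t. 2 * R t * norm (a t) + norm (b t) + norm (c t))"
    by (intro continuous_intros coeff_cont R_cont)
  moreover have "norm (F t x - F t y)
      \<le> (2 * R t * norm (a t) + norm (b t) + norm (c t)) * norm (x - y)" for t x y
  proof -
    note norm_riccati_field_diff_le[OF norm_radial_retraction_le[OF R_pos[of t], of x]
        norm_radial_retraction_le[OF R_pos[of t], of y], of "a t" "b t" "c t" "d t"]
    also have "(2 * R t * norm (a t) + norm (b t) + norm (c t))
        * norm (radial_retraction (R t) x - radial_retraction (R t) y)
      \<le> (2 * R t * norm (a t) + norm (b t) + norm (c t)) * norm (x - y)"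
      using R_pos[of t] by (intro mult_left_mono radial_retraction_nonexpansive) auto
    finally show ?thesis by (simp add: F_def)
  qed
  ultimately obtain x where x_start: "x t0 = x0"
    and x_deriv: "\<And>t. t0 \<le> t \<Longrightarrow> (x has_vector_derivative F t (x t)) (at t within {t0..})"
    using global_picard_lindeloef[of t0 F _ x0] by blast
  have coord_scale: "conj_coord n (r *\<^sub>R y) = r * conj_coord n y" for n r y
    using linear_simps(5)[OF bounded_linear_conj_coord] by simp
  have pos: "0 < conj_coord n (x t)" if "n \<le> 3" "t0 \<le> t" for n t
  proof (rule positive_if_inward_derivative[where I = "{..3}" and i = n and t = t])
    fix m t assume "m \<in> {..3::nat}" and t: "t0 \<le> t"
    show "((\<lambda>t. conj_coord m (x t)) has_real_derivative conj_coord m (F t (x t))) (at t within {t0..})"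
      using bounded_linear.has_vector_derivative[OF bounded_linear_conj_coord x_deriv[OF t]]
      by (simp add: has_real_derivative_iff_has_vector_derivative)
  next
    fix m t assume m: "m \<in> {..3::nat}" and t: "t0 \<le> t" and zero: "conj_coord m (x t) = 0"
      and nonneg: "\<And>j. j \<in> {..3} \<Longrightarrow> 0 \<le> conj_coord j (x t)"
    obtain r where "0 < r" and r: "radial_retraction (R t) (x t) = r *\<^sub>R x t"
      using radial_retraction_scales[OF R_pos] by metis
    show "0 < conj_coord m (F t (x t))"
      unfolding F_def r
      by (rule riccati_field_inward[where \<epsilon> = \<epsilon>])
         (use assms(5,6) t m zero nonneg \<open>0 < r\<close> in \<open>auto simp: coord_scale\<close>)
  qed (use that \<gamma> x0 x_start in auto)
  have bound: "norm (x t) \<le> R t" if "t0 \<le> t" for t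
  proof -
    have "(norm (x t))\<^sup>2 + 1 \<le> ((norm (x t0))\<^sup>2 + 1) * exp (integral {t0..t} C)"
    proof (rule gronwall_Ici[OF C _ _ that])
      fix t assume t: "t0 \<le> t"
      show "((\<lambda>t. (norm (x t))\<^sup>2 + 1) has_real_derivative 2 * (x t \<bullet> F t (x t))) (at t within {t0..})"
        using has_derivative_add_const[OF has_derivative_inner[OF
            x_deriv[OF t, unfolded has_vector_derivative_def]
            x_deriv[OF t, unfolded has_vector_derivative_def]], of 1]
        unfolding power2_norm_eq_inner has_field_derivative_def
        by (simp add: inner_commute mult_ac mult_commute_abs)
      obtain r where "0 < r" "r \<le> 1" and r: "radial_retraction (R t) (x t) = r *\<^sub>R x t"
        using radial_retraction_scales[OF R_pos] by metis
      have "0 < quat_comp (a t) m" if "m \<le> 3" for m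
        using that assms(6) t by (cases rule: le_3_cases)
          (auto simp: semi_definite_positive_def riccati_L0_def riccati_L1_def riccati_L2_def riccati_L3_def)
      then show "2 * (x t \<bullet> F t (x t)) \<le> C t * ((norm (x t))\<^sup>2 + 1)"
        unfolding F_def r C_def using pos t \<open>0 < r\<close> \<open>r \<le> 1\<close>
        by (intro inner_riccati_field_le) (auto intro: less_imp_le)
    qed
    then show ?thesis unfolding R_def x_start by (intro real_le_rsqrt) simp
  qed
  \<comment> \<open>The solution stays in the balls of radius \<open>R\<close>, where the truncation does nothing.\<close>
  have F_x: "F t (x t) = riccati_field (a t) (b t) (c t) (d t) (x t)" if "t0 \<le> t" for t
    using radial_retraction_inside[OF R_pos bound[OF that]] by (simp add: F_def)
  have x_cont: "continuous_on {t0..} x"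
    by (rule has_vector_derivative_Ici_imp_continuous_on) (rule x_deriv)
  have "riccati_solution a b c d t0 x"
    unfolding riccati_solution_def
  proof (intro exI conjI allI impI)
    show "continuous_on {t0..} (\<lambda>t. riccati_field (a t) (b t) (c t) (d t) (x t))"
      unfolding riccati_field_def by (intro continuous_intros coeff_cont x_cont)
  qed (use x_deriv F_x in \<open>auto simp: riccati_field_def\<close>)
  then show "\<exists>q :: nat \<Rightarrow> real \<Rightarrow> real.
        riccati_solution a b c d t0
          (\<lambda>t. of_real (q 0 t) - quat_i * of_real (q 1 t)
                - quat_j * of_real (q 2 t) - quat_k * of_real (q 3 t)) \<and>
        (\<forall>n\<le>3. q n t0 = \<gamma> n) \<and>
        (\<forall>t\<ge>t0. \<forall>n\<le>3. q n t > 0)"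
    using pos x0 by (intro exI[of _ "\<lambda>n t. conj_coord n (x t)"])
      (auto simp: x_start simp flip: quat_eq_conj_coords[unfolded One_nat_def])
qed

end
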